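(* Consider the constrained deterministic optimal control problem of minimizing $G(T)$ over complete trajectories $T\in C$, a base heuristic $R$, and the fortified rollout algorithm, all as defined in the context. Assume that the base heuristic generates a feasible complete trajectory starting from the initial state $\tilde y_0=\tilde x_0$, i.e., $R(\tilde y_0)\in C$ (the base heuristic is not assumed to be sequentially improving). Then the fortified rollout algorithm generates a complete trajectory $\tilde y_N$ that is feasible and whose cost is no worse than the cost of the complete trajectory generated by the base heuristic starting from $\tilde y_0$: $\tilde y_N\in C$ and $G(\tilde y_N)\le G\big(R(\tilde y_0)\big)$.
   Context: Problem. Let $N\ge 1$. For $k=0,\ldots,N-1$ there is a system equation $x_{k+1}=f_k(x_k,u_k)$, where the state $x_k$ takes values in some (possibly infinite) set, the control $u_k$ takes values in some finite set, and $f_k$ is a given function. The initial state $\tilde x_0$ is given. A complete trajectory is a sequence $T=(x_0,u_0,x_1,u_1,\ldots,u_{N-1},x_N)$ with $x_0=\tilde x_0$ and $x_{k+1}=f_k(x_k,u_k)$ for all $k=0,\ldots,N-1$. $G$ is a given real-valued cost function of complete trajectories and $C$ is a given set of complete trajectories (the constraint set); a complete trajectory is called feasible if it belongs to $C$. Partial trajectories and base heuristic. For $k=0,\ldots,N$, a partial trajectory $y_k=(x_0,u_0,x_1,\ldots,u_{k-1},x_k)$ starts at the given initial state and satisfies the system equation (so $y_0=\tilde x_0$, and $y_N$ is a complete trajectory). A base heuristic is a map $R$ that assigns to every such partial trajectory $y_k$ a complementary partial trajectory $R(y_k)=(x_k,u_k,x_{k+1},u_{k+1},\ldots,u_{N-1},x_N)$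 that starts at the last state $x_k$ of $y_k$ and satisfies $x_{t+1}=f_t(x_t,u_t)$ for $t=k,\ldots,N-1$; for $k=N$, $R(y_N)=(x_N)$. For $k=0,\ldots,N-1$, a partial trajectory $y_k$ with last state $x_k$, and a control $u_k$, let $y_{k+1}=\big(y_k,u_k,f_k(x_k,u_k)\big)$ and let $T_k(y_k,u_k)=\big(y_k,u_k,R(y_{k+1})\big)$ denote the complete trajectory obtained by joining $y_{k+1}$ and $R(y_{k+1})$ at their common state. Let $U_k(y_k)=\{u_k\mid T_k(y_k,u_k)\in C\}$. The base heuristic is called sequentially improving if for every $k=0,\ldots,N-1$ and every partial trajectory $y_k$ such that the complete trajectory $y_k\cup R(y_k)$ obtained by joining $y_k$ and $R(y_k)$ belongs to $C$, the set $U_k(y_k)$ is nonempty and $G\big(y_k\cup R(y_k)\big)\ge\min_{u_k\in U_k(y_k)}G\big(T_k(y_k,u_k)\big)$. Fortified rollout algorithm. At stage $k$ it maintains a partial trajectory $\tilde y_k=(\tilde x_0,\tilde u_0,\ldots,\tilde u_{k-1},\tilde x_k)$ and a complete trajectory $\hat T_k$, called the tentative best trajectory, which agrees with $\tilde y_k$ up to state $\tilde x_k$, i.e., has the form $$\hat T_k=(\tilde x_0,\tilde u_0,\tilde x_1,\ldots,\tilde u_{k-1},\tilde x_k,\bar u_k,\bar x_{k+1},\ldots,\bar u_{N-1},\bar x_N).$$ Initially $\tilde y_0=\tilde x_0$ and $\hat T_0=R(\tilde y_0)$. At stage $k=0,\ldots,N-1$ the algorithm forms $$\hat U_k(\tilde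 y_k)=\big\{u_k\in U_k(\tilde y_k)\mid G\big(T_k(\tilde y_k,u_k)\big)\le G(\hat T_k)\big\}.$$ (1) If $\hat U_k(\tilde y_k)$ is nonempty, it selects (with arbitrary tie-breaking) $\tilde u_k\in\arg\min_{u_k\in\hat U_k(\tilde y_k)}G\big(T_k(\tilde y_k,u_k)\big)$, sets $\tilde x_{k+1}=f_k(\tilde x_k,\tilde u_k)$, $\tilde y_{k+1}=(\tilde y_k,\tilde u_k,\tilde x_{k+1})$, and $\hat T_{k+1}=T_k(\tilde y_k,\tilde u_k)$. (2) If $\hat U_k(\tilde y_k)$ is empty, it sets $\tilde u_k=\bar u_k$, $\tilde x_{k+1}=\bar x_{k+1}$, where $\bar u_k,\bar x_{k+1}$ are the control and state subsequent to $\tilde x_k$ in $\hat T_k$, $\tilde y_{k+1}=(\tilde y_k,\tilde u_k,\tilde x_{k+1})$, and $\hat T_{k+1}=\hat T_k$. *)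

theory Defs
  imports Complex_Main
begin

(* Traj [x_k, ..., x_m] [u_k, ..., u_(m-1)] stands for (x_k, u_k, x_(k+1), ..., u_(m-1), x_m).
   The stage k of the first state is not stored: it is an argument of is_segment. *)
datatype ('x, 'u) traj = Traj (states: "'x list") (controls: "'u list")

record ('x, 'u) control_problem =
  horizon :: nat
  state_space :: "nat \<Rightarrow> 'x set"
  control_space :: "nat \<Rightarrow> 'u set"
  dynamics :: "nat \<Rightarrow> 'x \<Rightarrow> 'u \<Rightarrow> 'x"
  initial :: 'x
  cost :: "('x, 'u) traj \<Rightarrow> real"
  constraint :: "('x, 'u) traj set"

definition is_segment ::
  "('x, 'u) control_problem \<Rightarrow> nat \<Rightarrow> nat \<Rightarrow> ('x, 'u) traj \<Rightarrow> bool" where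
  "is_segment P k m y \<longleftrightarrow>
     k \<le> m \<and>
     length (states y) = Suc (m - k) \<and>
     length (controls y) = m - k \<and>
     (\<forall>i \<le> m - k. states y ! i \<in> state_space P (k + i)) \<and>
     (\<forall>i < m - k. controls y ! i \<in> control_space P (k + i) \<and>
        states y ! Suc i = dynamics P (k + i) (states y ! i) (controls y ! i))"

definition partial_traj ::
  "('x, 'u) control_problem \<Rightarrow> nat \<Rightarrow> ('x, 'u) traj \<Rightarrow> bool" where
  "partial_traj P k y \<longleftrightarrow> is_segment P 0 k y \<and> hd (states y) = initial P"

definition complete_traj :: "('x, 'u) control_problem \<Rightarrow> ('x, 'u) traj \<Rightarrow> bool" where
  "complete_traj P y \<longleftrightarrow> partial_traj P (horizon P) y"

definition is_problem :: "('x, 'u) control_problem \<Rightarrow> bool" where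
  "is_problem P \<longleftrightarrow>
     horizon P \<ge> 1 \<and>
     (\<forall>k < horizon P. finite (control_space P k)) \<and>
     (\<forall>k < horizon P. \<forall>x \<in> state_space P k. \<forall>u \<in> control_space P k.
        dynamics P k x u \<in> state_space P (Suc k)) \<and>
     initial P \<in> state_space P 0 \<and>
     (\<forall>y \<in> constraint P. complete_traj P y)"

definition initial_traj :: "('x, 'u) control_problem \<Rightarrow> ('x, 'u) traj" where
  "initial_traj P = Traj [initial P] []"

(* The last state of the first trajectory is the first state of the second one;
   it is kept only once. *)
definition join :: "('x, 'u) traj \<Rightarrow> ('x, 'u) traj \<Rightarrow> ('x, 'u) traj" where
  "join y z = Traj (states y @ tl (states z)) (controls y @ controls z)"

definition extend :: "('x, 'u) traj \<Rightarrow> 'u \<Rightarrow> 'x \<Rightarrow> ('x, 'u) traj" where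
  "extend y u x = Traj (states y @ [x]) (controls y @ [u])"

(* For k = horizon P this forces R y to consist of the last state of y only. *)
definition base_heuristic ::
  "('x, 'u) control_problem \<Rightarrow> (('x, 'u) traj \<Rightarrow> ('x, 'u) traj) \<Rightarrow> bool" where
  "base_heuristic P R \<longleftrightarrow>
     (\<forall>k \<le> horizon P. \<forall>y. partial_traj P k y \<longrightarrow>
        is_segment P k (horizon P) (R y) \<and> hd (states (R y)) = last (states y))"

definition next_traj ::
  "('x, 'u) control_problem \<Rightarrow> nat \<Rightarrow> ('x, 'u) traj \<Rightarrow> 'u \<Rightarrow> ('x, 'u) traj" where
  "next_traj P k y u = extend y u (dynamics P k (last (states y)) u)"

(* T_k(y_k, u_k) *)
definition heuristic_completion ::
  "('x, 'u) control_problem \<Rightarrow> (('x, 'u) traj \<Rightarrow> ('x, 'u) traj) \<Rightarrow> nat \<Rightarrow>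
     ('x, 'u) traj \<Rightarrow> 'u \<Rightarrow> ('x, 'u) traj" where
  "heuristic_completion P R k y u = join (next_traj P k y u) (R (next_traj P k y u))"

(* U_k(y_k) *)
definition feasible_controls ::
  "('x, 'u) control_problem \<Rightarrow> (('x, 'u) traj \<Rightarrow> ('x, 'u) traj) \<Rightarrow> nat \<Rightarrow>
     ('x, 'u) traj \<Rightarrow> 'u set" where
  "feasible_controls P R k y =
     {u \<in> control_space P k. heuristic_completion P R k y u \<in> constraint P}"

(* The set of feasible controls that do not worsen the tentative best trajectory T. *)
definition fortified_controls ::
  "('x, 'u) control_problem \<Rightarrow> (('x, 'u) traj \<Rightarrow> ('x, 'u) traj) \<Rightarrow> nat \<Rightarrow>
     ('x, 'u) traj \<Rightarrow> ('x, 'u) traj \<Rightarrow> 'u set" where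
  "fortified_controls P R k y T =
     {u \<in> feasible_controls P R k y. cost P (heuristic_completion P R k y u) \<le> cost P T}"

(* fortified_step P R k y T y' T': at stage k the algorithm can move from the partial
   trajectory y and tentative best trajectory T to y' and T'.  The relation is
   nondeterministic because ties in the minimization are broken arbitrarily. *)
inductive fortified_step ::
  "('x, 'u) control_problem \<Rightarrow> (('x, 'u) traj \<Rightarrow> ('x, 'u) traj) \<Rightarrow> nat \<Rightarrow>
     ('x, 'u) traj \<Rightarrow> ('x, 'u) traj \<Rightarrow> ('x, 'u) traj \<Rightarrow> ('x, 'u) traj \<Rightarrow> bool"
  for P R k y T where
  select:
    "fortified_controls P R k y T \<noteq> {} \<Longrightarrow>
     is_arg_min (\<lambda>u. cost P (heuristic_completion P R k y u))
       (\<lambda>u. u \<in> fortified_controls P R k y T) u \<Longrightarrow>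
     fortified_step P R k y T (next_traj P k y u) (heuristic_completion P R k y u)"
| keep:
    "fortified_controls P R k y T = {} \<Longrightarrow>
     fortified_step P R k y T (extend y (controls T ! k) (states T ! Suc k)) T"

(* fortified_rollout P R k y T: some run of the algorithm reaches stage k with partial
   trajectory y and tentative best trajectory T. *)
inductive fortified_rollout ::
  "('x, 'u) control_problem \<Rightarrow> (('x, 'u) traj \<Rightarrow> ('x, 'u) traj) \<Rightarrow> nat \<Rightarrow>
     ('x, 'u) traj \<Rightarrow> ('x, 'u) traj \<Rightarrow> bool"
  for P R where
  start: "fortified_rollout P R 0 (initial_traj P) (R (initial_traj P))"
| step:
    "k < horizon P \<Longrightarrow> fortified_rollout P R k y T \<Longrightarrow>
     fortified_step P R k y T y' T' \<Longrightarrow> fortified_rollout P R (Suc k) y' T'"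

end

(* The tentative best trajectory is feasible at every stage, its cost never increases, and the
   current partial trajectory is its initial part.  At stage N the initial part is all of it.
   Fortification is what makes this work without sequential improvement: a stage at which the
   heuristic finds nothing better just follows the tentative best trajectory. *)
theory Submission
  imports Defs
begin

text \<open>Serves to express that the tentative best trajectory agrees with the current partial
  trajectory \<open>y\<close> up to stage \<open>k\<close>, as the equation
  \<open>y = prefix_traj k T\<close>.\<close>

definition prefix_traj :: "nat \<Rightarrow> ('x, 'u) traj \<Rightarrow> ('x, 'u) traj" where
  "prefix_traj k T = Traj (take (Suc k) (states T)) (take k (controls T))"

lemma length_complete_traj:
  assumes "complete_traj P T"
  shows "length (states T) = Suc (horizon P)" "length (controls T) = horizon P"
  using assms by (simp_all add: complete_traj_def partial_traj_def is_segment_def)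

text \<open>The right-hand side is the move of rule \<open>keep\<close>, so following
  \<open>T\<close> for one stage preserves the prefix equation.\<close>

lemma prefix_traj_Suc:
  assumes "complete_traj P T" "k < horizon P"
  shows "prefix_traj (Suc k) T = extend (prefix_traj k T) (controls T ! k) (states T ! Suc k)"
  using length_complete_traj[OF assms(1)] assms(2)
  by (simp add: prefix_traj_def extend_def take_Suc_conv_app_nth)

lemma prefix_traj_horizon:
  assumes "complete_traj P T"
  shows "prefix_traj (horizon P) T = T"
  using length_complete_traj[OF assms] by (simp add: prefix_traj_def)

lemma prefix_traj_0:
  assumes "complete_traj P T"
  shows "prefix_traj 0 T = initial_traj P"
  using assms
  by (cases "states T")
    (auto simp: prefix_traj_def initial_traj_def complete_traj_def partial_traj_def is_segment_def)

text \<open>\<open>join\<close> only appends to \<open>y\<close>. This gives the prefix equation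
  after rule \<open>select\<close>.\<close>

lemma prefix_traj_join:
  assumes "length (states y) = Suc k" "length (controls y) = k"
  shows "prefix_traj k (join y z) = y"
  using assms by (simp add: prefix_traj_def join_def)

lemma complete_traj_if_constraint:
  "is_problem P \<Longrightarrow> T \<in> constraint P \<Longrightarrow> complete_traj P T"
  by (simp add: is_problem_def)

text \<open>Feasibility also supports the prefix equation: it makes \<open>T\<close> complete, which
  fixes the lengths of its lists.\<close>

lemma fortified_rollout_invariant:
  assumes P: "is_problem P" and R: "R (initial_traj P) \<in> constraint P"
    and run: "fortified_rollout P R k y T"
  shows "T \<in> constraint P \<and> cost P T \<le> cost P (R (initial_traj P)) \<and> y = prefix_traj k T"
  using run
proof induction
  case start
  show ?case
    using R prefix_traj_0[OF complete_traj_if_constraint[OF P R]] by simp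
next
  case (step k y T y' T')
  then have T: "complete_traj P T" and y: "y = prefix_traj k T"
    using complete_traj_if_constraint[OF P] by auto
  from step.hyps(3) show ?case
  proof cases
    case (select u)
    \<comment> \<open>The lengths of \<open>y\<close> come from its being a prefix of the complete
      \<open>T\<close> with \<open>k < horizon P\<close>.\<close>
    have "length (states (next_traj P k y u)) = Suc (Suc k)"
      "length (controls (next_traj P k y u)) = Suc k"
      using length_complete_traj[OF T] step.hyps(1) y
      by (simp_all add: next_traj_def extend_def prefix_traj_def)
    then have "y' = prefix_traj (Suc k) T'"
      unfolding select heuristic_completion_def by (simp add: prefix_traj_join)
    \<comment> \<open>Membership gives both feasibility of \<open>T'\<close> and cost at most that
      of \<open>T\<close>.\<close>
    moreover have "u \<in> fortified_controls P R k y T"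
      using select by (simp add: is_arg_min_def)
    ultimately show ?thesis
      using step.IH select by (auto simp: fortified_controls_def feasible_controls_def)
  next
    case keep
    then show ?thesis
      using step.IH prefix_traj_Suc[OF T step.hyps(1)] by simp
  qed
qed

text \<open>The two rules split on emptiness of the fortified set; if it is nonempty, finiteness of
  the control space yields a minimizer.\<close>

lemma fortified_step_exists:
  assumes "is_problem P" "k < horizon P"
  shows "\<exists>y' T'. fortified_step P R k y T y' T'"
proof (cases "fortified_controls P R k y T = {}")
  case True
  then show ?thesis by (blast intro: fortified_step.keep)
next
  case False
  have "finite (fortified_controls P R k y T)"
    using assms by (simp add: is_problem_def fortified_controls_def feasible_controls_def)
  from ex_is_arg_min_if_finite[OF this False] False
  show ?thesis by (blast intro: fortified_step.select)
qed

text \<open>Ensures that the guarantee for all finished runs is not vacuous.\<close>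

lemma fortified_rollout_exists:
  assumes "is_problem P" "k \<le> horizon P"
  shows "\<exists>y T. fortified_rollout P R k y T"
  using assms(2)
proof (induction k)
  case 0
  show ?case by (blast intro: fortified_rollout.start)
next
  case (Suc k)
  then obtain y T where "fortified_rollout P R k y T" by auto
  moreover obtain y' T' where "fortified_step P R k y T y' T'"
    using fortified_step_exists[OF assms(1)] Suc.prems by (meson Suc_le_lessD)
  ultimately show ?case
    using Suc.prems by (meson Suc_le_lessD fortified_rollout.step)
qed

theorem mainTheorem2:
  fixes P :: "('x, 'u) control_problem"
    and R :: "('x, 'u) traj \<Rightarrow> ('x, 'u) traj"
  assumes "is_problem P"
    and "base_heuristic P R"
    and "R (initial_traj P) \<in> constraint P"
  shows "(\<forall>k < horizon P. \<forall>y T. fortified_rollout P R k y T \<longrightarrow>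
            (\<exists>y' T'. fortified_step P R k y T y' T'))
       \<and> (\<exists>y T. fortified_rollout P R (horizon P) y T)
       \<and> (\<forall>y T. fortified_rollout P R (horizon P) y T \<longrightarrow>
            complete_traj P y \<and> y \<in> constraint P
            \<and> cost P y \<le> cost P (R (initial_traj P)))"
proof (intro conjI allI impI)
  fix k y T
  assume "k < horizon P"
  then show "\<exists>y' T'. fortified_step P R k y T y' T'"
    by (rule fortified_step_exists[OF assms(1)])
next
  show "\<exists>y T. fortified_rollout P R (horizon P) y T"
    using fortified_rollout_exists[OF assms(1)] by blast
next
  fix y T
  assume "fortified_rollout P R (horizon P) y T"
  then have T: "T \<in> constraint P" "cost P T \<le> cost P (R (initial_traj P))"
    and y: "y = prefix_traj (horizon P) T"
    using fortified_rollout_invariant[of P R, OF assms(1,3)] by blast+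
  \<comment> \<open>Completeness fixes the lengths in \<open>T\<close>, so cutting at the horizon
    removes nothing.\<close>
  have "complete_traj P T"
    using complete_traj_if_constraint[OF assms(1) T(1)] .
  moreover from this have "y = T"
    using y prefix_traj_horizon by simp
  ultimately show "complete_traj P y" "y \<in> constraint P"
    "cost P y \<le> cost P (R (initial_traj P))"
    using T by simp_all
qed

end
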